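(* A displacement field $\mathbf{u}:\Omega\to\mathbb{R}^3$ is universal for the trigonal class $\mathbb{Z}_3$ of linear strain-gradient elastic solids if and only if it is the superposition (sum) of a homogeneous displacement field and a field $\mathbf{u}^{\mathrm{inh}}$ of the form $$u_1^{\mathrm{inh}}=a_{12}x_1x_2+a_{13}x_1x_3+a_{23}x_2x_3,\qquad u_2^{\mathrm{inh}}=\tfrac12a_{12}(x_1^2-x_2^2)+b_{13}x_1x_3-a_{13}x_2x_3,$$ $$u_3^{\mathrm{inh}}=-(a_{23}+b_{13})x_1x_2-a_{13}(x_1^2-x_2^2),$$ for some constants $a_{12},a_{13},a_{23},b_{13}\in\mathbb{R}$.
   Context: $\Omega\subset\mathbb{R}^3$ is a nonempty convex open set with Cartesian coordinates $(x_1,x_2,x_3)$ and orthonormal basis $e_1,e_2,e_3$. Repeated indices are summed over $1,2,3$ and a comma denotes partial differentiation. A displacement field is a smooth map $\mathbf{u}:\Omega\to\mathbb{R}^3$, with strain $e_{lm}=\tfrac12(u_{l,m}+u_{m,l})$. It is homogeneous if $\mathbf{u}(\mathbf{x})=\mathbf{H}\mathbf{x}+\mathbf{b}$ for a constant matrix $\mathbf{H}$ and constant vector $\mathbf{b}$. A strain-gradient material is a triple $(\mathsf{C},\mathsf{M},\mathsf{A})$ of constant real tensors of orders $4,5,6$ with index symmetries $\mathsf{C}_{ijlm}=\mathsf{C}_{jilm}=\mathsf{C}_{lmij}$, $\mathsf{M}_{ijklm}=\mathsf{M}_{jiklm}=\mathsf{M}_{ijlkm}$, $\mathsf{A}_{ijklmn}=\mathsf{A}_{jiklmn}=\mathsf{A}_{lmnijk}$.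 Its stress and hyper-stress are $\sigma_{ij}=\mathsf{C}_{ijlm}e_{lm}+\mathsf{M}_{ijlmn}e_{lm,n}$ and $\tau_{ijk}=\mathsf{M}_{lmijk}e_{lm}+\mathsf{A}_{ijklmn}e_{lm,n}$, and the equilibrium equations without body forces are $\sigma_{ij,j}-\tau_{ijk,jk}=0$ in $\Omega$ for $i=1,2,3$. For a subgroup $G\subset \mathrm{O}(3)$, a tensor $T$ of order $p$ is $G$-invariant if $Q_{i_1j_1}\cdots Q_{i_pj_p}T_{j_1\dots j_p}=T_{i_1\dots i_p}$ for all $Q\in G$. $\mathbb{Z}_3$ is generated by the rotation by $2\pi/3$ about $e_3$; $\mathbb{D}_3$ is generated by $\mathbb{Z}_3$ and the rotation by $\pi$ about $e_2$; $\mathbb{Z}_2^c=\{I,-I\}$, and $G\oplus\mathbb{Z}_2^c$ is the group generated by $G$ and $-I$. The trigonal class $\mathbb{Z}_3$ is the set of all materials with $\mathsf{C}$ $\mathbb{D}_3\oplus\mathbb{Z}_2^c$-invariant (6 independent constants), $\mathsf{M}$ $\mathbb{Z}_3$-invariant (36 independent constants), and $\mathsf{A}$ $\mathbb{Z}_3\oplus\mathbb{Z}_2^c$-invariant (57 independent constants). A displacement field is universal for the class if it satisfies the equilibrium equations for every material in the class. *)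

theory Defs
  imports "HOL-Analysis.Analysis" "HOL-Algebra.Generated_Groups"
begin

section \<open>Smooth displacement fields\<close>

text \<open>The index type is \<^typ>\<open>3\<close>, whose elements are 1, 2 and 3 (where 3 = 0).\<close>

definition pd :: "3 \<Rightarrow> (real^3 \<Rightarrow> real) \<Rightarrow> real^3 \<Rightarrow> real" where
  "pd j f x = deriv (\<lambda>t. f (x + t *\<^sub>R axis j 1)) 0"

text \<open>For open \<open>\<Omega>\<close>, this is the usual class of \<open>k\<close> times continuously differentiable
  functions on \<open>\<Omega>\<close>; values outside \<open>\<Omega>\<close> are irrelevant.\<close>

primrec Ck_on :: "nat \<Rightarrow> (real^3) set \<Rightarrow> (real^3 \<Rightarrow> real) \<Rightarrow> bool" where
  "Ck_on 0 \<Omega> f \<longleftrightarrow> continuous_on \<Omega> f"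
| "Ck_on (Suc k) \<Omega> f \<longleftrightarrow> f differentiable_on \<Omega> \<and> (\<forall>j. Ck_on k \<Omega> (pd j f))"

definition displacement_field :: "(real^3) set \<Rightarrow> (real^3 \<Rightarrow> real^3) \<Rightarrow> bool" where
  "displacement_field \<Omega> u \<longleftrightarrow> (\<forall>i k. Ck_on k \<Omega> (\<lambda>x. u x $ i))"

definition homogeneous :: "(real^3) set \<Rightarrow> (real^3 \<Rightarrow> real^3) \<Rightarrow> bool" where
  "homogeneous \<Omega> u \<longleftrightarrow> (\<exists>(H :: real^3^3) b. \<forall>x\<in>\<Omega>. u x = H *v x + b)"

definition strain :: "(real^3 \<Rightarrow> real^3) \<Rightarrow> 3 \<Rightarrow> 3 \<Rightarrow> real^3 \<Rightarrow> real" where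
  "strain u l m x = (pd m (\<lambda>y. u y $ l) x + pd l (\<lambda>y. u y $ m) x) / 2"


section \<open>Strain-gradient materials\<close>

type_synonym tensor4 = "3 \<Rightarrow> 3 \<Rightarrow> 3 \<Rightarrow> 3 \<Rightarrow> real"
type_synonym tensor5 = "3 \<Rightarrow> 3 \<Rightarrow> 3 \<Rightarrow> 3 \<Rightarrow> 3 \<Rightarrow> real"
type_synonym tensor6 = "3 \<Rightarrow> 3 \<Rightarrow> 3 \<Rightarrow> 3 \<Rightarrow> 3 \<Rightarrow> 3 \<Rightarrow> real"
type_synonym material = "tensor4 \<times> tensor5 \<times> tensor6"

definition strain_gradient_material :: "material \<Rightarrow> bool" where
  "strain_gradient_material = (\<lambda>(C, M, A).
     (\<forall>i j l m. C i j l m = C j i l m \<and> C i j l m = C l m i j) \<and>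
     (\<forall>i j k l m. M i j k l m = M j i k l m \<and> M i j k l m = M i j l k m) \<and>
     (\<forall>i j k l m n. A i j k l m n = A j i k l m n \<and> A i j k l m n = A l m n i j k))"

definition stress :: "material \<Rightarrow> (real^3 \<Rightarrow> real^3) \<Rightarrow> 3 \<Rightarrow> 3 \<Rightarrow> real^3 \<Rightarrow> real" where
  "stress = (\<lambda>(C, M, A) u i j x.
     (\<Sum>l\<in>UNIV. \<Sum>m\<in>UNIV. C i j l m * strain u l m x) +
     (\<Sum>l\<in>UNIV. \<Sum>m\<in>UNIV. \<Sum>n\<in>UNIV. M i j l m n * pd n (strain u l m) x))"

definition hyper_stress :: "material \<Rightarrow> (real^3 \<Rightarrow> real^3) \<Rightarrow> 3 \<Rightarrow> 3 \<Rightarrow> 3 \<Rightarrow> real^3 \<Rightarrow> real" where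
  "hyper_stress = (\<lambda>(C, M, A) u i j k x.
     (\<Sum>l\<in>UNIV. \<Sum>m\<in>UNIV. M l m i j k * strain u l m x) +
     (\<Sum>l\<in>UNIV. \<Sum>m\<in>UNIV. \<Sum>n\<in>UNIV. A i j k l m n * pd n (strain u l m) x))"

definition equilibrium :: "(real^3) set \<Rightarrow> material \<Rightarrow> (real^3 \<Rightarrow> real^3) \<Rightarrow> bool" where
  "equilibrium \<Omega> S u \<longleftrightarrow> (\<forall>x\<in>\<Omega>. \<forall>i.
     (\<Sum>j\<in>UNIV. pd j (stress S u i j) x) -
     (\<Sum>j\<in>UNIV. \<Sum>k\<in>UNIV. pd k (pd j (hyper_stress S u i j k)) x) = 0)"

definition universal :: "(real^3) set \<Rightarrow> material set \<Rightarrow> (real^3 \<Rightarrow> real^3) \<Rightarrow> bool" where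
  "universal \<Omega> \<M> u \<longleftrightarrow> (\<forall>S\<in>\<M>. equilibrium \<Omega> S u)"


section \<open>Symmetry groups and tensor invariance\<close>

definition O3 :: "(real^3^3) monoid" where
  "O3 = \<lparr>carrier = {Q. orthogonal_matrix Q}, mult = (**), one = mat 1\<rparr>"

lemma group_O3: "group O3"
proof (rule groupI)
  fix Q assume "Q \<in> carrier O3"
  then show "\<exists>P\<in>carrier O3. P \<otimes>\<^bsub>O3\<^esub> Q = \<one>\<^bsub>O3\<^esub>"
    by (intro bexI[of _ "transpose Q"]) (auto simp: O3_def orthogonal_matrix_def)
qed (auto simp: O3_def orthogonal_matrix_mul orthogonal_matrix_id matrix_mul_assoc)

definition rot_e3 :: "real \<Rightarrow> real^3^3" where
  "rot_e3 t = vector [vector [cos t, - sin t, 0],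
                      vector [sin t,   cos t, 0],
                      vector [    0,       0, 1]]"

definition rot_e2 :: "real \<Rightarrow> real^3^3" where
  "rot_e2 t = vector [vector [  cos t, 0, sin t],
                      vector [      0, 1,     0],
                      vector [- sin t, 0, cos t]]"

lemma rot_e3_in_O3: "rot_e3 t \<in> carrier O3"
  and rot_e2_in_O3: "rot_e2 t \<in> carrier O3"
  by (auto simp: O3_def orthogonal_matrix rot_e3_def rot_e2_def vec_eq_iff forall_3 sum_3
      matrix_matrix_mult_def transpose_def mat_def vector_3 simp flip: power2_eq_square)

definition Z3 :: "(real^3^3) set" where
  "Z3 = generate O3 {rot_e3 (2 * pi / 3)}"

definition D3 :: "(real^3^3) set" where
  "D3 = generate O3 (Z3 \<union> {rot_e2 pi})"

definition oplus_Z2c :: "(real^3^3) set \<Rightarrow> (real^3^3) set" where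
  "oplus_Z2c G = generate O3 (G \<union> {- mat 1})"

definition invariant4 :: "(real^3^3) set \<Rightarrow> tensor4 \<Rightarrow> bool" where
  "invariant4 G T \<longleftrightarrow> (\<forall>Q\<in>G. \<forall>i1 i2 i3 i4.
     (\<Sum>j1\<in>UNIV. \<Sum>j2\<in>UNIV. \<Sum>j3\<in>UNIV. \<Sum>j4\<in>UNIV.
        Q$i1$j1 * Q$i2$j2 * Q$i3$j3 * Q$i4$j4 * T j1 j2 j3 j4) = T i1 i2 i3 i4)"

definition invariant5 :: "(real^3^3) set \<Rightarrow> tensor5 \<Rightarrow> bool" where
  "invariant5 G T \<longleftrightarrow> (\<forall>Q\<in>G. \<forall>i1 i2 i3 i4 i5.
     (\<Sum>j1\<in>UNIV. \<Sum>j2\<in>UNIV. \<Sum>j3\<in>UNIV. \<Sum>j4\<in>UNIV. \<Sum>j5\<in>UNIV.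
        Q$i1$j1 * Q$i2$j2 * Q$i3$j3 * Q$i4$j4 * Q$i5$j5 * T j1 j2 j3 j4 j5)
     = T i1 i2 i3 i4 i5)"

definition invariant6 :: "(real^3^3) set \<Rightarrow> tensor6 \<Rightarrow> bool" where
  "invariant6 G T \<longleftrightarrow> (\<forall>Q\<in>G. \<forall>i1 i2 i3 i4 i5 i6.
     (\<Sum>j1\<in>UNIV. \<Sum>j2\<in>UNIV. \<Sum>j3\<in>UNIV. \<Sum>j4\<in>UNIV. \<Sum>j5\<in>UNIV. \<Sum>j6\<in>UNIV.
        Q$i1$j1 * Q$i2$j2 * Q$i3$j3 * Q$i4$j4 * Q$i5$j5 * Q$i6$j6 * T j1 j2 j3 j4 j5 j6)
     = T i1 i2 i3 i4 i5 i6)"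

definition trigonal_Z3 :: "material set" where
  "trigonal_Z3 = {(C, M, A). strain_gradient_material (C, M, A) \<and>
     invariant4 (oplus_Z2c D3) C \<and> invariant5 Z3 M \<and> invariant6 (oplus_Z2c Z3) A}"


section \<open>The inhomogeneous fields\<close>

definition u_inh :: "real \<Rightarrow> real \<Rightarrow> real \<Rightarrow> real \<Rightarrow> real^3 \<Rightarrow> real^3" where
  "u_inh a12 a13 a23 b13 x = vector
     [a12 * x$1 * x$2 + a13 * x$1 * x$3 + a23 * x$2 * x$3,
      a12 * ((x$1)\<^sup>2 - (x$2)\<^sup>2) / 2 + b13 * x$1 * x$3 - a13 * x$2 * x$3,
      - (a23 + b13) * x$1 * x$2 - a13 * ((x$1)\<^sup>2 - (x$2)\<^sup>2)]"

end

theory Submission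
  imports Defs
begin

text \<open>
  Equilibrium is linear in the material, so testing with \<open>\<M> = 0\<close>, \<open>\<A> = 0\<close> and
  with \<open>\<C> = 0\<close>, \<open>\<A> = 0\<close> isolates conditions on the second and on the third gradient
  of the displacement. Invariant tensors are obtained as multilinear forms in the inner product, the
  third coordinate and the real and imaginary parts of \<open>z(u) z(v) z(w)\<close> with
  \<open>z(u) = u\<^sub>1 + \<i> u\<^sub>2\<close>; a rotation by \<open>2\<pi>/3\<close> multiplies \<open>z\<close> by a cube root of unity. The six
  elastic forms force the second gradient, at each point, into a four-parameter space. Applied to
  the third gradient as well, they leave a single free parameter there, which one coupling tensor
  \<open>\<M>\<close> kills. Hence the second gradient is constant and the displacement is quadratic.
  Conversely, for such a quadratic displacement only the elastic terms survive, and they vanish by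
  the linear relations that the symmetries impose on \<open>\<C>\<close>.
\<close>

section \<open>Partial derivatives of smooth functions\<close>

lemma pd_eq_derivative:
  assumes "(f has_derivative f') (at x)"
  shows "pd j f x = f' (axis j 1)"
proof -
  have f: "(f has_derivative f') (at (x + 0 *\<^sub>R axis j 1))"
    using assms by simp
  have "((\<lambda>t. f (x + t *\<^sub>R axis j 1)) has_derivative (\<lambda>t. f' (t *\<^sub>R axis j 1))) (at 0)"
    by (rule has_derivative_compose[where g = f and f = "\<lambda>t. x + t *\<^sub>R axis j 1", OF _ f])
       (auto intro!: derivative_eq_intros)
  moreover have "f' (t *\<^sub>R axis j 1) = t * f' (axis j 1)" for t
    using linear_scale[OF has_derivative_linear[OF assms]] by simp
  ultimately have "((\<lambda>t. f (x + t *\<^sub>R axis j 1)) has_field_derivative f' (axis j 1)) (at 0)"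
    by (simp add: has_field_derivative_def mult.commute[of _ "f' (axis j 1)"])
  then show ?thesis
    unfolding pd_def by (rule DERIV_imp_deriv)
qed

lemma has_derivative_pd:
  assumes "f differentiable (at x)"
  shows "(f has_derivative (\<lambda>h. \<Sum>j\<in>UNIV. h $ j * pd j f x)) (at x)"
proof -
  obtain f' where f': "(f has_derivative f') (at x)"
    using assms by (auto simp: differentiable_def)
  have lin: "linear f'"
    by (rule has_derivative_linear[OF f'])
  have "f' h = (\<Sum>j\<in>UNIV. h $ j * pd j f x)" for h
  proof -
    have "f' h = f' (\<Sum>j\<in>UNIV. h $ j *\<^sub>R axis j 1)"
      by (simp add: basis_expansion flip: scalar_mult_eq_scaleR)
    also have "\<dots> = (\<Sum>j\<in>UNIV. h $ j * pd j f x)"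
      by (simp add: linear_sum[OF lin] linear_scale[OF lin] pd_eq_derivative[OF f'])
    finally show ?thesis .
  qed
  then have "f' = (\<lambda>h. \<Sum>j\<in>UNIV. h $ j * pd j f x)"
    by blast
  with f' show ?thesis by simp
qed

text \<open>\<open>pd\<close> sees only values on a short segment through \<open>x\<close>, which
  stays in the open set. This permits differentiating identities that are known only inside
  \<Omega>.\<close>

lemma pd_cong:
  assumes "open \<Omega>" "x \<in> \<Omega>" "\<And>y. y \<in> \<Omega> \<Longrightarrow> f y = g y"
  shows "pd j f x = pd j g x"
proof -
  have "((\<lambda>t. x + t *\<^sub>R axis j 1) \<longlongrightarrow> x + 0 *\<^sub>R axis j 1) (nhds (0::real))"
    by (intro tendsto_intros filterlim_ident)
  then have "eventually (\<lambda>t. x + t *\<^sub>R axis j 1 \<in> \<Omega>) (nhds (0::real))"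
    using assms(1,2) by (simp add: topological_tendstoD)
  then have "eventually (\<lambda>t. f (x + t *\<^sub>R axis j 1) = g (x + t *\<^sub>R axis j 1)) (nhds (0::real))"
    by eventually_elim (simp add: assms(3))
  then show ?thesis
    unfolding pd_def by (rule deriv_cong_ev) simp
qed

lemma pd_const [simp]: "pd j (\<lambda>x. c) x = 0"
  by (simp add: pd_def)

lemma pd_add:
  assumes "f differentiable (at x)" "g differentiable (at x)"
  shows "pd j (\<lambda>y. f y + g y) x = pd j f x + pd j g x"
proof -
  obtain f' g' where d: "(f has_derivative f') (at x)" "(g has_derivative g') (at x)"
    using assms by (auto simp: differentiable_def)
  show ?thesis
    using pd_eq_derivative[OF has_derivative_add[OF d]] pd_eq_derivative[OF d(1)]
      pd_eq_derivative[OF d(2)] by simp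
qed

lemma pd_cmult:
  assumes "f differentiable (at x)"
  shows "pd j (\<lambda>y. c * f y) x = c * pd j f x"
proof -
  obtain f' where d: "(f has_derivative f') (at x)"
    using assms by (auto simp: differentiable_def)
  show ?thesis
    using pd_eq_derivative[OF has_derivative_mult_right[OF d, of c]] pd_eq_derivative[OF d] by simp
qed

section \<open>The class of smooth functions\<close>

definition smooth_on :: "(real^3) set \<Rightarrow> (real^3 \<Rightarrow> real) \<Rightarrow> bool" where
  "smooth_on \<Omega> f \<longleftrightarrow> (\<forall>k. Ck_on k \<Omega> f)"

lemma Ck_on_cong:
  assumes "open \<Omega>" "\<And>y. y \<in> \<Omega> \<Longrightarrow> f y = g y" "Ck_on k \<Omega> f"
  shows "Ck_on k \<Omega> g"
  using assms(2,3)
proof (induction k arbitrary: f g)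
  case 0
  then show ?case by (simp cong: continuous_on_cong)
next
  case (Suc k)
  have "g differentiable_on \<Omega>"
    unfolding differentiable_on_def
  proof
    fix x assume "x \<in> \<Omega>"
    then show "g differentiable at x within \<Omega>"
      using Suc.prems by (intro differentiable_transform_within[of f x \<Omega> 1 g])
        (auto simp: differentiable_on_def)
  qed
  moreover have "Ck_on k \<Omega> (pd j g)" for j
  proof (rule Suc.IH[of "pd j f"])
    show "pd j f y = pd j g y" if "y \<in> \<Omega>" for y
      by (rule pd_cong[OF assms(1) that Suc.prems(1)])
  qed (use Suc.prems(2) in simp)
  ultimately show ?case by simp
qed

lemma smooth_onD:
  assumes "smooth_on \<Omega> f"
  shows smooth_on_imp_differentiable: "open \<Omega> \<Longrightarrow> x \<in> \<Omega> \<Longrightarrow> f differentiable (at x)"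
    and smooth_on_pd: "smooth_on \<Omega> (pd j f)"
    and smooth_on_imp_continuous_on: "continuous_on \<Omega> f"
proof -
  have "Ck_on 0 \<Omega> f" "Ck_on (Suc k) \<Omega> f" for k
    using assms by (auto simp: smooth_on_def)
  then show "open \<Omega> \<Longrightarrow> x \<in> \<Omega> \<Longrightarrow> f differentiable (at x)"
    "smooth_on \<Omega> (pd j f)" "continuous_on \<Omega> f"
    by (auto simp: smooth_on_def differentiable_on_eq_differentiable_at)
qed

lemma Ck_on_add:
  assumes "open \<Omega>" "Ck_on k \<Omega> f" "Ck_on k \<Omega> g"
  shows "Ck_on k \<Omega> (\<lambda>x. f x + g x)"
  using assms(2,3)
proof (induction k arbitrary: f g)
  case 0
  then show ?case by (simp add: continuous_on_add)
next
  case (Suc k)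
  have "Ck_on k \<Omega> (pd j (\<lambda>x. f x + g x))" for j
    by (rule Ck_on_cong[OF assms(1) _ Suc.IH[of "pd j f" "pd j g"]])
       (use Suc.prems assms(1) in \<open>auto simp: pd_add differentiable_on_eq_differentiable_at\<close>)
  then show ?case using Suc.prems by simp
qed

lemma Ck_on_cmult:
  assumes "open \<Omega>" "Ck_on k \<Omega> f"
  shows "Ck_on k \<Omega> (\<lambda>x. c * f x)"
  using assms(2)
proof (induction k arbitrary: f)
  case 0
  then show ?case by (simp add: continuous_on_mult_left)
next
  case (Suc k)
  have "Ck_on k \<Omega> (pd j (\<lambda>x. c * f x))" for j
    by (rule Ck_on_cong[OF assms(1) _ Suc.IH[of "pd j f"]])
       (use Suc.prems assms(1) in \<open>auto simp: pd_cmult differentiable_on_eq_differentiable_at\<close>)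
  then show ?case using Suc.prems by (simp add: differentiable_on_mult)
qed

lemma smooth_on_add: "open \<Omega> \<Longrightarrow> smooth_on \<Omega> f \<Longrightarrow> smooth_on \<Omega> g \<Longrightarrow> smooth_on \<Omega> (\<lambda>x. f x + g x)"
  by (simp add: smooth_on_def Ck_on_add)

lemma smooth_on_cmult: "open \<Omega> \<Longrightarrow> smooth_on \<Omega> f \<Longrightarrow> smooth_on \<Omega> (\<lambda>x. c * f x)"
  by (simp add: smooth_on_def Ck_on_cmult)

lemma pd_sum:
  assumes "\<And>i. i \<in> I \<Longrightarrow> f i differentiable (at x)"
  shows "pd j (\<lambda>y. \<Sum>i\<in>I. f i y) x = (\<Sum>i\<in>I. pd j (f i) x)"
  using assms
proof (induction I rule: infinite_finite_induct)
  case (insert i I)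
  then show ?case by (simp add: pd_add differentiable_sum)
qed auto

lemma sum_axis: "(\<Sum>j\<in>UNIV. axis i (1::real) $ j * g j) = g i"
proof -
  have "axis i (1::real) $ j * g j = (if j = i then g j else 0)" for j
    by (simp add: axis_def)
  then show ?thesis by simp
qed

section \<open>Symmetry of second partial derivatives\<close>

lemma has_real_derivative_pd:
  assumes "f differentiable (at (x + t *\<^sub>R axis i 1))"
  shows "((\<lambda>t. f (x + t *\<^sub>R axis i 1)) has_real_derivative pd i f (x + t *\<^sub>R axis i 1)) (at t)"
proof -
  have "((\<lambda>t. f (x + t *\<^sub>R axis i 1)) has_derivative
      (\<lambda>h. \<Sum>j\<in>UNIV. (h *\<^sub>R axis i 1) $ j * pd j f (x + t *\<^sub>R axis i 1))) (at t)"
    by (rule has_derivative_compose[where g = f and f = "\<lambda>t. x + t *\<^sub>R axis i 1", OF _ has_derivative_pd[OF assms]])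
       (auto intro!: derivative_eq_intros)
  moreover have "(\<Sum>j\<in>UNIV. (h *\<^sub>R axis i 1) $ j * pd j f (x + t *\<^sub>R axis i 1))
      = pd i f (x + t *\<^sub>R axis i 1) * h" for h :: real
    by (simp add: mult.assoc sum_axis flip: sum_distrib_left)
  ultimately show ?thesis by (simp add: has_field_derivative_def)
qed

text \<open>The second difference is written symmetrically in \<open>i\<close> and \<open>j\<close>, so that the lemma also
  applies with the two directions exchanged.\<close>

lemma second_difference_pd:
  assumes "0 < s"
    and "\<And>a b. 0 \<le> a \<Longrightarrow> a \<le> s \<Longrightarrow> 0 \<le> b \<Longrightarrow> b \<le> s \<Longrightarrow>
           f differentiable (at (x + a *\<^sub>R axis i 1 + b *\<^sub>R axis j 1))"
    and "\<And>a b. 0 \<le> a \<Longrightarrow> a \<le> s \<Longrightarrow> 0 \<le> b \<Longrightarrow> b \<le> s \<Longrightarrow>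
           pd i f differentiable (at (x + a *\<^sub>R axis i 1 + b *\<^sub>R axis j 1))"
  obtains a b where "0 < a" "a < s" "0 < b" "b < s"
    "f (x + s *\<^sub>R axis i 1 + s *\<^sub>R axis j 1) + f x - (f (x + s *\<^sub>R axis i 1) + f (x + s *\<^sub>R axis j 1))
      = s\<^sup>2 * pd j (pd i f) (x + a *\<^sub>R axis i 1 + b *\<^sub>R axis j 1)"
proof -
  let ?g = "\<lambda>t. f (x + s *\<^sub>R axis j 1 + t *\<^sub>R axis i 1) - f (x + t *\<^sub>R axis i 1)"
  have g: "(?g has_real_derivative
      pd i f (x + s *\<^sub>R axis j 1 + t *\<^sub>R axis i 1) - pd i f (x + t *\<^sub>R axis i 1)) (at t)"
    if "0 \<le> t" "t \<le> s" for t
    using assms(2)[of t s] assms(2)[of t 0] that \<open>0 < s\<close>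
    by (intro DERIV_diff has_real_derivative_pd) (auto simp: add_ac)
  obtain a where a: "0 < a" "a < s"
    "?g s - ?g 0 = (s - 0) * (pd i f (x + s *\<^sub>R axis j 1 + a *\<^sub>R axis i 1) - pd i f (x + a *\<^sub>R axis i 1))"
    using MVT2[OF \<open>0 < s\<close> g] by auto
  have h: "((\<lambda>t. pd i f (x + a *\<^sub>R axis i 1 + t *\<^sub>R axis j 1)) has_real_derivative
      pd j (pd i f) (x + a *\<^sub>R axis i 1 + t *\<^sub>R axis j 1)) (at t)"
    if "0 \<le> t" "t \<le> s" for t
    using assms(3)[of a t] that a by (intro has_real_derivative_pd) auto
  obtain b where b: "0 < b" "b < s"
    "pd i f (x + a *\<^sub>R axis i 1 + s *\<^sub>R axis j 1) - pd i f (x + a *\<^sub>R axis i 1 + 0 *\<^sub>R axis j 1)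
      = (s - 0) * pd j (pd i f) (x + a *\<^sub>R axis i 1 + b *\<^sub>R axis j 1)"
    using MVT2[OF \<open>0 < s\<close> h] by auto
  show thesis
  proof (rule that[OF a(1,2) b(1,2)])
    show "f (x + s *\<^sub>R axis i 1 + s *\<^sub>R axis j 1) + f x - (f (x + s *\<^sub>R axis i 1) + f (x + s *\<^sub>R axis j 1))
      = s\<^sup>2 * pd j (pd i f) (x + a *\<^sub>R axis i 1 + b *\<^sub>R axis j 1)"
      using a(3) b(3) by (simp add: algebra_simps power2_eq_square)
  qed
qed

text \<open>Schwarz's theorem. By \<open>second_difference_pd\<close>, one and the same second
  difference equals the square of \<open>s\<close> times either mixed partial at some nearby point;
  continuity of both then excludes a gap between their values at \<open>x\<close>.\<close>

lemma pd_commute: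
  assumes "open \<Omega>" "x \<in> \<Omega>" "smooth_on \<Omega> f"
  shows "pd i (pd j f) x = pd j (pd i f) x"
proof (rule ccontr)
  assume ne: "pd i (pd j f) x \<noteq> pd j (pd i f) x"
  \<comment> \<open>Half the gap: a common value cannot lie at distance less than \<open>e\<close>
    from both mixed partials at \<open>x\<close>.\<close>
  define e where "e = \<bar>pd i (pd j f) x - pd j (pd i f) x\<bar> / 2"
  have "e > 0" using ne by (simp add: e_def)
  have close: "\<exists>d>0. \<forall>y. dist y x < d \<longrightarrow> \<bar>pd k (pd l f) y - pd k (pd l f) x\<bar> < e" for k l
  proof -
    have "continuous (at x) (pd k (pd l f))"
      using assms by (intro continuous_on_interior[of \<Omega>])
        (auto intro!: smooth_on_imp_continuous_on smooth_on_pd simp: interior_open)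
    then show ?thesis
      using \<open>e > 0\<close> by (simp add: continuous_at_eps_delta dist_real_def)
  qed
  obtain d1 where d1: "d1 > 0" "\<And>y. dist y x < d1 \<Longrightarrow> \<bar>pd i (pd j f) y - pd i (pd j f) x\<bar> < e"
    using close by blast
  obtain d2 where d2: "d2 > 0" "\<And>y. dist y x < d2 \<Longrightarrow> \<bar>pd j (pd i f) y - pd j (pd i f) x\<bar> < e"
    using close by blast
  obtain d3 where d3: "d3 > 0" "ball x d3 \<subseteq> \<Omega>"
    using assms by (meson openE)
  define d where "d = Min {d1, d2, d3}"
  have d: "d > 0" "d \<le> d1" "d \<le> d2" "d \<le> d3"
    using d1(1) d2(1) d3(1) by (auto simp: d_def)
  \<comment> \<open>Moving by at most \<open>s\<close> along each of two axes displaces a point by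
    at most 2d/3, hence by less than \<open>d\<close>.\<close>
  define s where "s = d / 3"
  have "s > 0" using d by (simp add: s_def)
  have near: "dist (x + a *\<^sub>R axis k 1 + b *\<^sub>R axis l 1) x < d"
    if "0 \<le> a" "a \<le> s" "0 \<le> b" "b \<le> s" for a b and k l :: 3
  proof -
    have "norm (a *\<^sub>R axis k 1 + b *\<^sub>R axis l (1::real)) \<le> \<bar>a\<bar> + \<bar>b\<bar>"
      by (rule order.trans[OF norm_triangle_ineq]) simp
    also have "\<dots> < d" using that d(1) by (simp add: s_def)
    finally show ?thesis by (simp add: dist_norm add.assoc)
  qed
  have inO: "x + a *\<^sub>R axis k 1 + b *\<^sub>R axis l 1 \<in> \<Omega>"
    if "0 \<le> a" "a \<le> s" "0 \<le> b" "b \<le> s" for a b and k l :: 3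
    using near[OF that, of k l] d(4) d3(2) by (auto simp: mem_ball dist_commute)
  note diff = smooth_on_imp_differentiable[OF _ assms(1) inO]
  obtain a b where 1: "0 < a" "a < s" "0 < b" "b < s"
    "f (x + s *\<^sub>R axis i 1 + s *\<^sub>R axis j 1) + f x - (f (x + s *\<^sub>R axis i 1) + f (x + s *\<^sub>R axis j 1))
      = s\<^sup>2 * pd j (pd i f) (x + a *\<^sub>R axis i 1 + b *\<^sub>R axis j 1)"
    by (rule second_difference_pd[OF \<open>s > 0\<close>, of f x i j]) (auto intro!: diff smooth_on_pd assms(3))
  obtain a' b' where 2: "0 < a'" "a' < s" "0 < b'" "b' < s"
    "f (x + s *\<^sub>R axis j 1 + s *\<^sub>R axis i 1) + f x - (f (x + s *\<^sub>R axis j 1) + f (x + s *\<^sub>R axis i 1))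
      = s\<^sup>2 * pd i (pd j f) (x + a' *\<^sub>R axis j 1 + b' *\<^sub>R axis i 1)"
    by (rule second_difference_pd[OF \<open>s > 0\<close>, of f x j i]) (auto intro!: diff smooth_on_pd assms(3))
  have "s\<^sup>2 * pd j (pd i f) (x + a *\<^sub>R axis i 1 + b *\<^sub>R axis j 1)
      = s\<^sup>2 * pd i (pd j f) (x + a' *\<^sub>R axis j 1 + b' *\<^sub>R axis i 1)"
    using 1(5) 2(5) by (simp add: add_ac)
  then have "pd j (pd i f) (x + a *\<^sub>R axis i 1 + b *\<^sub>R axis j 1)
      = pd i (pd j f) (x + a' *\<^sub>R axis j 1 + b' *\<^sub>R axis i 1)"
    using \<open>s > 0\<close> by simp
  moreover have "\<bar>pd j (pd i f) (x + a *\<^sub>R axis i 1 + b *\<^sub>R axis j 1) - pd j (pd i f) x\<bar> < e"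
    using near[of a b i j] 1(1-4) d(3) by (intro d2(2)) auto
  moreover have "\<bar>pd i (pd j f) (x + a' *\<^sub>R axis j 1 + b' *\<^sub>R axis i 1) - pd i (pd j f) x\<bar> < e"
    using near[of a' b' j i] 2(1-4) d(2) by (intro d1(2)) auto
  ultimately show False by (simp add: e_def abs_if split: if_splits)
qed

section \<open>Functions with constant second partial derivatives\<close>

lemma pd_zero_imp_constant:
  assumes "open \<Omega>" "convex \<Omega>"
    and "\<And>x. x \<in> \<Omega> \<Longrightarrow> f differentiable (at x)"
    and "\<And>x j. x \<in> \<Omega> \<Longrightarrow> pd j f x = 0"
  obtains c where "\<And>x. x \<in> \<Omega> \<Longrightarrow> f x = c"
proof -
  have "(f has_derivative (\<lambda>h. 0)) (at x within \<Omega>)" if "x \<in> \<Omega>" for x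
    using has_derivative_pd[OF assms(3)[OF that]] assms(4)[OF that]
    by (auto intro: has_derivative_at_withinI)
  from has_derivative_zero_constant[OF assms(2) this] that show ?thesis by blast
qed

text \<open>With the factor 1/2, a symmetric \<open>q\<close> is the Hessian itself, and
  \<open>h\<close> is the gradient at the origin.\<close>

definition quadratic :: "(3 \<Rightarrow> real) \<Rightarrow> (3 \<Rightarrow> 3 \<Rightarrow> real) \<Rightarrow> real^3 \<Rightarrow> real" where
  "quadratic h q x = (\<Sum>k\<in>UNIV. h k * x $ k) + (\<Sum>k\<in>UNIV. \<Sum>l\<in>UNIV. q k l * x $ k * x $ l) / 2"

lemma has_derivative_vec_nth [derivative_intros]: "((\<lambda>x. x $ k) has_derivative (\<lambda>d. d $ k)) F"
  by (rule bounded_linear_imp_has_derivative[OF bounded_linear_vec_nth])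

lemma has_derivative_quadratic:
  assumes "\<forall>k l. q k l = q l k"
  shows "(quadratic h q has_derivative
    (\<lambda>d. \<Sum>m\<in>UNIV. d $ m * (h m + (\<Sum>k\<in>UNIV. q m k * x $ k)))) (at x)"
proof -
  have q: "q 2 1 = q 1 2" "q 3 1 = q 1 3" "q 3 2 = q 2 3"
    using assms by auto
  have "(quadratic h q has_derivative (\<lambda>d. (\<Sum>k\<in>UNIV. h k * d $ k) +
      (\<Sum>k\<in>UNIV. \<Sum>l\<in>UNIV. q k l * x $ k * d $ l + q k l * d $ k * x $ l) / 2)) (at x)"
    unfolding quadratic_def[abs_def]
    by (intro has_derivative_add has_derivative_sum bounded_linear.has_derivative[OF bounded_linear_divide])
       (auto intro!: derivative_eq_intros)
  then show ?thesis
    by (rule has_derivative_eq_rhs) (simp add: sum_3 q fun_eq_iff field_simps)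
qed

lemma pd_quadratic:
  assumes "\<forall>k l. q k l = q l k"
  shows "pd m (quadratic h q) x = h m + (\<Sum>k\<in>UNIV. q m k * x $ k)"
  using pd_eq_derivative[OF has_derivative_quadratic[OF assms, of h x], of m]
  by (simp add: sum_axis)

lemma has_derivative_linear_form:
  "((\<lambda>x :: real^3. c + (\<Sum>k\<in>UNIV. r k * x $ k)) has_derivative (\<lambda>d. \<Sum>k\<in>UNIV. r k * d $ k)) (at x)"
  by (auto intro!: derivative_eq_intros)

lemma pd_linear_form: "pd j (\<lambda>x. c + (\<Sum>k\<in>UNIV. r k * x $ k)) x = r j"
  using pd_eq_derivative[OF has_derivative_linear_form[of c r x], of j]
  by (simp add: sum_axis mult.commute[of "r _"])

text \<open>Two integrations on a convex set: subtracting from each first partial its expected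
  linear part leaves a constant \<open>h m\<close>, and subtracting the quadratic with these
  coefficients from \<open>f\<close> leaves the constant \<open>b\<close>.\<close>

lemma second_pd_const_imp_quadratic:
  assumes "open \<Omega>" "convex \<Omega>" "smooth_on \<Omega> f" "\<forall>k l. q k l = q l k"
    and "\<And>x j m. x \<in> \<Omega> \<Longrightarrow> pd j (pd m f) x = q m j"
  obtains h b where "\<And>x. x \<in> \<Omega> \<Longrightarrow> f x = quadratic h q x + b"
proof -
  note diff = smooth_on_imp_differentiable[OF _ assms(1)]
  \<comment> \<open>The shapes \<open>- 1 * ...\<close> and \<open>0 + ...\<close> are kept so that
    \<open>pd_add\<close>, \<open>pd_cmult\<close> and \<open>pd_linear_form\<close> match
    literally.\<close>
  have lin: "(\<lambda>x :: real^3. - 1 * (0 + (\<Sum>k\<in>UNIV. r k * x $ k))) differentiable (at y)" for r y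
    using has_derivative_linear_form[of 0 r y] by (intro differentiable_mult differentiable_const) (auto simp: differentiable_def)
  have "\<exists>c. \<forall>x\<in>\<Omega>. pd m f x + - 1 * (0 + (\<Sum>k\<in>UNIV. q m k * x $ k)) = c" for m
  proof (rule pd_zero_imp_constant[OF assms(1,2), of "\<lambda>x. pd m f x + - 1 * (0 + (\<Sum>k\<in>UNIV. q m k * x $ k))"])
    fix x j assume x: "x \<in> \<Omega>"
    show "(\<lambda>x. pd m f x + - 1 * (0 + (\<Sum>k\<in>UNIV. q m k * x $ k))) differentiable at x"
      by (intro differentiable_add lin diff[OF smooth_on_pd[OF assms(3)] x])
    have "pd j (\<lambda>x. pd m f x + - 1 * (0 + (\<Sum>k\<in>UNIV. q m k * x $ k))) x
      = pd j (pd m f) x + pd j (\<lambda>x. - 1 * (0 + (\<Sum>k\<in>UNIV. q m k * x $ k))) x"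
      by (intro pd_add lin diff[OF smooth_on_pd[OF assms(3)] x])
    also have "pd j (\<lambda>x. - 1 * (0 + (\<Sum>k\<in>UNIV. q m k * x $ k))) x = - 1 * q m j"
      using has_derivative_linear_form[of 0 "q m" x]
      by (subst pd_cmult) (auto simp: differentiable_def pd_linear_form simp del: add_0)
    finally show "pd j (\<lambda>x. pd m f x + - 1 * (0 + (\<Sum>k\<in>UNIV. q m k * x $ k))) x = 0"
      using assms(5)[OF x] by simp
  qed blast
  then obtain h where "\<forall>m. \<forall>x\<in>\<Omega>. pd m f x + - 1 * (0 + (\<Sum>k\<in>UNIV. q m k * x $ k)) = h m"
    by metis
  then have h: "pd m f x = h m + (\<Sum>k\<in>UNIV. q m k * x $ k)" if "x \<in> \<Omega>" for m x
    using that by (simp add: diff_eq_eq)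
  have quad: "quadratic h q differentiable (at y)" for y
    using has_derivative_quadratic[OF assms(4)] by (auto simp: differentiable_def)
  obtain b where "\<And>x. x \<in> \<Omega> \<Longrightarrow> f x + - 1 * quadratic h q x = b"
  proof (rule pd_zero_imp_constant[OF assms(1,2), of "\<lambda>x. f x + - 1 * quadratic h q x"])
    fix x j assume x: "x \<in> \<Omega>"
    show "(\<lambda>x. f x + - 1 * quadratic h q x) differentiable at x"
      by (intro differentiable_add differentiable_mult differentiable_const quad diff[OF assms(3) x])
    have "pd j (\<lambda>x. f x + - 1 * quadratic h q x) x = pd j f x + pd j (\<lambda>x. - 1 * quadratic h q x) x"
      by (intro pd_add differentiable_mult differentiable_const quad diff[OF assms(3) x])
    also have "pd j (\<lambda>x. - 1 * quadratic h q x) x = - 1 * pd j (quadratic h q) x"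
      by (intro pd_cmult quad)
    finally show "pd j (\<lambda>x. f x + - 1 * quadratic h q x) x = 0"
      using h[OF x] by (simp add: pd_quadratic[OF assms(4)])
  qed blast
  then show ?thesis
    by (intro that[of h b]) (simp add: algebra_simps)
qed

lemma second_pd_quadratic:
  assumes "open \<Omega>" "x \<in> \<Omega>" "\<forall>k l. q k l = q l k"
    and "\<And>x. x \<in> \<Omega> \<Longrightarrow> f x = quadratic h q x + b"
  shows "pd j (pd m f) x = q m j"
proof -
  have diff: "quadratic h q differentiable (at y)" for y
    using has_derivative_quadratic[OF assms(3)] by (auto simp: differentiable_def)
  have "pd m f y = h m + (\<Sum>k\<in>UNIV. q m k * y $ k)" if "y \<in> \<Omega>" for y
  proof -
    have "pd m f y = pd m (\<lambda>x. quadratic h q x + b) y"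
      by (rule pd_cong[OF assms(1) that assms(4)])
    then show ?thesis
      by (simp add: pd_add diff pd_quadratic[OF assms(3)])
  qed
  then have "pd j (pd m f) x = pd j (\<lambda>y. h m + (\<Sum>k\<in>UNIV. q m k * y $ k)) x"
    by (rule pd_cong[OF assms(1,2)])
  then show ?thesis by (simp add: pd_linear_form)
qed


section \<open>Invariant tensors\<close>

lemma inv_O3:
  assumes "Q \<in> carrier O3"
  shows "inv\<^bsub>O3\<^esub> Q = transpose Q"
  using assms by (intro group.inv_equality[OF group_O3]) (auto simp: O3_def orthogonal_matrix_def)

text \<open>The family \<open>v\<close> collects all arguments of a form \<open>F\<close>, so one
  induction serves every tensor order. Products act twice; for inverses, the hypothesis is used at
  the family already multiplied by the transpose.\<close>

lemma generate_O3_invariant: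
  assumes "S \<subseteq> carrier O3"
    and "\<And>Q v. Q \<in> S \<Longrightarrow> F (\<lambda>k. v k v* Q) = F v"
    and "Q \<in> generate O3 S"
  shows "F (\<lambda>k. v k v* Q) = F v"
  using assms(3)
proof (induction Q arbitrary: v rule: generate.induct)
  case one
  then show ?case by (simp add: O3_def)
next
  case (incl Q)
  then show ?case by (rule assms(2))
next
  case (inv Q)
  then have Q: "Q \<in> carrier O3" using assms(1) by blast
  have "x v* transpose Q v* Q = x" for x
    using Q by (simp add: O3_def orthogonal_matrix_def vector_matrix_mul_assoc del: vector_transpose_matrix)
  then show ?case
    using assms(2)[OF inv, of "\<lambda>k. v k v* transpose Q"]
    by (simp add: inv_O3[OF Q] del: vector_transpose_matrix)
next
  case (eng P Q)
  have "F (\<lambda>k. v k v* (P \<otimes>\<^bsub>O3\<^esub> Q)) = F (\<lambda>k. v k v* P v* Q)"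
    by (simp add: O3_def vector_matrix_mul_assoc)
  also have "\<dots> = F v"
    by (simp add: eng.IH)
  finally show ?case .
qed

lemma Z3_subset_O3: "Z3 \<subseteq> carrier O3"
  unfolding Z3_def by (intro group.generate_incl[OF group_O3]) (simp add: rot_e3_in_O3)

lemma D3_subset_O3: "D3 \<subseteq> carrier O3"
  unfolding D3_def
  by (intro group.generate_incl[OF group_O3]) (use Z3_subset_O3 rot_e2_in_O3 in auto)

lemma minus_mat_1_in_O3: "- mat 1 \<in> carrier O3"
  by (auto simp: O3_def orthogonal_matrix_def matrix_matrix_mult_def transpose_def mat_def
      vec_eq_iff forall_3 sum_3)

text \<open>The group is generated in nested stages, so invariance climbs from \<open>Z3\<close> to
  \<open>D3\<close> and then to the inversion; only three generators have to be tested.\<close>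

lemma oplus_Z2c_D3_invariant:
  assumes "\<And>v. F (\<lambda>k. v k v* rot_e3 (2 * pi / 3)) = F v"
    and "\<And>v. F (\<lambda>k. v k v* rot_e2 pi) = F v"
    and "\<And>v. F (\<lambda>k. - v k) = F v"
    and "Q \<in> oplus_Z2c D3"
  shows "F (\<lambda>k. v k v* Q) = F v"
proof -
  have Z3: "F (\<lambda>k. v k v* Q) = F v" if "Q \<in> Z3" for Q v
    by (rule generate_O3_invariant[OF _ _ that[unfolded Z3_def]]) (auto simp: rot_e3_in_O3 assms(1))
  have D3: "F (\<lambda>k. v k v* Q) = F v" if "Q \<in> D3" for Q v
    by (rule generate_O3_invariant[OF _ _ that[unfolded D3_def]])
      (use Z3 Z3_subset_O3 rot_e2_in_O3 assms(2) in auto)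
  have "x v* - mat 1 = - x" for x :: "real^3"
    by (simp add: vec_eq_iff vector_matrix_mult_def mat_def forall_3 sum_3)
  then show ?thesis
    by (intro generate_O3_invariant[OF _ _ assms(4)[unfolded oplus_Z2c_def]])
      (use D3 D3_subset_O3 minus_mat_1_in_O3 assms(3) in auto)
qed

lemma Z3_invariant:
  assumes "\<And>v. F (\<lambda>k. v k v* rot_e3 (2 * pi / 3)) = F v" "Q \<in> Z3"
  shows "F (\<lambda>k. v k v* Q) = F v"
  by (rule generate_O3_invariant[OF _ _ assms(2)[unfolded Z3_def]]) (auto simp: rot_e3_in_O3 assms(1))

text \<open>The vector \<open>axis i 1 v* Q\<close> is row \<open>i\<close> of \<open>Q\<close>.
  Acting by \<open>v*\<close> rather than \<open>*v\<close> produces the coefficients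
  \<open>Q $ i $ j\<close> in the index order of the invariance definitions.\<close>

lemma linear_axis_mult:
  fixes g :: "real^3 \<Rightarrow> real"
  assumes "linear g"
  shows "g (axis i 1 v* Q) = (\<Sum>j\<in>UNIV. Q $ i $ j * g (axis j 1))"
proof -
  have "axis i 1 v* Q = (\<Sum>j\<in>UNIV. Q $ i $ j *\<^sub>R axis j 1)"
    by (simp add: vec_eq_iff vector_matrix_mult_def axis_def sum.delta
        if_distrib[of "\<lambda>a. a * _"] if_distrib[of "\<lambda>a. _ * a"] mult.commute cong: if_cong)
  then show ?thesis
    by (simp add: linear_sum[OF assms] linear_scale[OF assms])
qed

text \<open>Expanding each argument by linearity turns the invariance of a form into the index
  identity for its values on basis vectors.\<close>

lemma invariant4_form:
  assumes lin: "\<And>v w y. linear (\<lambda>u. f u v w y)" "\<And>u w y. linear (\<lambda>v. f u v w y)"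
      "\<And>u v y. linear (\<lambda>w. f u v w y)" "\<And>u v w. linear (\<lambda>y. f u v w y)"
    and inv: "\<And>Q u v w y. Q \<in> G \<Longrightarrow>
      f (u v* Q) (v v* Q) (w v* Q) (y v* Q) = f u v w y"
  shows "invariant4 G (\<lambda>i j l m. f (axis i 1) (axis j 1) (axis l 1) (axis m 1))"
  unfolding invariant4_def
proof (intro ballI allI)
  fix Q i1 i2 i3 i4 assume "Q \<in> G"
  from inv[OF this, of "axis i1 1" "axis i2 1" "axis i3 1" "axis i4 1"]
  show "(\<Sum>j1\<in>UNIV. \<Sum>j2\<in>UNIV. \<Sum>j3\<in>UNIV. \<Sum>j4\<in>UNIV.
        Q$i1$j1 * Q$i2$j2 * Q$i3$j3 * Q$i4$j4 * f (axis j1 1) (axis j2 1) (axis j3 1) (axis j4 1))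
      = f (axis i1 1) (axis i2 1) (axis i3 1) (axis i4 1)"
    unfolding linear_axis_mult[OF lin(1)] unfolding linear_axis_mult[OF lin(2)]
    unfolding linear_axis_mult[OF lin(3)] unfolding linear_axis_mult[OF lin(4)]
    by (simp only: sum_distrib_left mult.assoc)
qed

lemma invariant5_form:
  assumes lin: "\<And>v w y t. linear (\<lambda>u. f u v w y t)" "\<And>u w y t. linear (\<lambda>v. f u v w y t)"
      "\<And>u v y t. linear (\<lambda>w. f u v w y t)" "\<And>u v w t. linear (\<lambda>y. f u v w y t)"
      "\<And>u v w y. linear (\<lambda>t. f u v w y t)"
    and inv: "\<And>Q u v w y t. Q \<in> G \<Longrightarrow> f (u v* Q) (v v* Q)
      (w v* Q) (y v* Q) (t v* Q) = f u v w y t"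
  shows "invariant5 G (\<lambda>i j l m n. f (axis i 1) (axis j 1) (axis l 1) (axis m 1) (axis n 1))"
  unfolding invariant5_def
proof (intro ballI allI)
  fix Q i1 i2 i3 i4 i5 assume "Q \<in> G"
  from inv[OF this, of "axis i1 1" "axis i2 1" "axis i3 1" "axis i4 1" "axis i5 1"]
  show "(\<Sum>j1\<in>UNIV. \<Sum>j2\<in>UNIV. \<Sum>j3\<in>UNIV. \<Sum>j4\<in>UNIV. \<Sum>j5\<in>UNIV.
        Q$i1$j1 * Q$i2$j2 * Q$i3$j3 * Q$i4$j4 * Q$i5$j5 *
        f (axis j1 1) (axis j2 1) (axis j3 1) (axis j4 1) (axis j5 1))
      = f (axis i1 1) (axis i2 1) (axis i3 1) (axis i4 1) (axis i5 1)"
    unfolding linear_axis_mult[OF lin(1)] unfolding linear_axis_mult[OF lin(2)]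
    unfolding linear_axis_mult[OF lin(3)] unfolding linear_axis_mult[OF lin(4)]
    unfolding linear_axis_mult[OF lin(5)] by (simp only: sum_distrib_left mult.assoc)
qed

section \<open>Complex description of the threefold rotation\<close>

definition plane :: "real^3 \<Rightarrow> complex" where
  "plane u = Complex (u $ 1) (u $ 2)"

lemma plane_add: "plane (u + v) = plane u + plane v"
  and plane_scaleR: "plane (r *\<^sub>R u) = of_real r * plane u"
  and plane_uminus: "plane (- u) = - plane u"
  by (auto simp: plane_def complex_eq_iff)

lemma plane_axis: "plane (axis i 1) = (if i = 1 then 1 else if i = 2 then \<i> else 0)"
  using exhaust_3[of i] by (auto simp: plane_def axis_def complex_eq_iff)

text \<open>\<open>v*\<close> applies the transposed rotation, hence the negative angle.\<close>

lemma plane_rot_e3: "plane (u v* rot_e3 t) = cis (- t) * plane u"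
  and rot_e3_nth_3: "(u v* rot_e3 t) $ 3 = u $ 3"
  by (auto simp: plane_def rot_e3_def vector_matrix_mult_def sum_3 complex_eq_iff
      vector_3 algebra_simps)

text \<open>The rotation sends (u1, u2, u3) to (- u1, u2, - u3), which on the plane is minus
  conjugation.\<close>

lemma plane_rot_e2_pi: "plane (u v* rot_e2 pi) = - cnj (plane u)"
  and rot_e2_pi_nth_3: "(u v* rot_e2 pi) $ 3 = - u $ 3"
  by (auto simp: plane_def rot_e2_def vector_matrix_mult_def sum_3 complex_eq_iff
      vector_3)

lemma rot_e3_cube:
  "(cis (- (2 * pi / 3)) * a) * (cis (- (2 * pi / 3)) * b) * (cis (- (2 * pi / 3)) * c) = a * b * c"
proof -
  have "cis (- (2 * pi / 3)) ^ 3 = cis (- (2 * pi))"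
    by (subst Complex.DeMoivre) simp
  also have "\<dots> = 1"
    by (simp add: complex_eq_iff)
  finally have "cis (- (2 * pi / 3)) ^ 3 * (a * b * c) = a * b * c"
    by simp
  then show ?thesis by (simp add: power3_eq_cube mult_ac)
qed

lemma inner_mult_O3:
  assumes "Q \<in> carrier O3"
  shows "(u v* Q) \<bullet> (v v* Q) = u \<bullet> v"
proof -
  have "Q ** transpose Q = mat 1"
    using assms by (simp add: O3_def orthogonal_matrix_def)
  then show ?thesis
    by (metis dot_lmul_matrix matrix_vector_mul_assoc matrix_vector_mul_lid transpose_matrix_vector)
qed

definition re3 :: "real^3 \<Rightarrow> real^3 \<Rightarrow> real^3 \<Rightarrow> real" where
  "re3 u v w = Re (plane u * plane v * plane w)"

definition im3 :: "real^3 \<Rightarrow> real^3 \<Rightarrow> real^3 \<Rightarrow> real" where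
  "im3 u v w = Im (plane u * plane v * plane w)"

lemma re3_rot_e3:
    "re3 (u v* rot_e3 (2 * pi / 3)) (v v* rot_e3 (2 * pi / 3)) (w v* rot_e3 (2 * pi / 3)) = re3 u v w"
  and im3_rot_e3:
    "im3 (u v* rot_e3 (2 * pi / 3)) (v v* rot_e3 (2 * pi / 3)) (w v* rot_e3 (2 * pi / 3)) = im3 u v w"
  by (simp_all only: re3_def im3_def plane_rot_e3 rot_e3_cube)

text \<open>Under this rotation and under inversion (\<open>re3_uminus\<close>), \<open>re3\<close>
  is odd just as the third coordinate is, so their product is invariant.\<close>

lemma re3_rot_e2_pi: "re3 (u v* rot_e2 pi) (v v* rot_e2 pi) (w v* rot_e2 pi) = - re3 u v w"
  by (simp add: re3_def plane_rot_e2_pi algebra_simps)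

lemma re3_uminus: "re3 (- u) (- v) (- w) = - re3 u v w"
  by (simp add: re3_def plane_uminus)

text \<open>A six-parameter family of elasticities. The terms of \<open>c 0\<close> to
  \<open>c 4\<close> are invariant under every rotation about the third axis; the last is the
  genuinely trigonal one. Summing over placements of the arguments gives the index symmetries of
  \<open>C\<close>.\<close>

definition elastic_form :: "(nat \<Rightarrow> real) \<Rightarrow> real^3 \<Rightarrow> real^3 \<Rightarrow> real^3 \<Rightarrow> real^3 \<Rightarrow> real" where
  "elastic_form c u v w y =
     c 0 * ((u \<bullet> v) * (w \<bullet> y)) +
     c 1 * ((u \<bullet> w) * (v \<bullet> y) + (u \<bullet> y) * (v \<bullet> w)) +
     c 2 * (u$3 * v$3 * w$3 * y$3) +
     c 3 * ((u \<bullet> v) * w$3 * y$3 + (w \<bullet> y) * u$3 * v$3) +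
     c 4 * ((u \<bullet> w) * v$3 * y$3 + (u \<bullet> y) * v$3 * w$3 + (v \<bullet> w) * u$3 * y$3 + (v \<bullet> y) * u$3 * w$3) +
     c 5 * (re3 u v w * y$3 + re3 u v y * w$3 + re3 u w y * v$3 + re3 v w y * u$3)"

lemma elastic_form_commute: "elastic_form c u v w y = elastic_form c v u w y"
  by (simp add: elastic_form_def re3_def inner_commute ac_simps)

lemma elastic_form_swap: "elastic_form c u v w y = elastic_form c w y u v"
  by (simp add: elastic_form_def re3_def inner_commute ac_simps)

lemma linear_elastic_form: "linear (\<lambda>u. elastic_form c u v w y)"
  by (rule linearI)
     (simp_all add: elastic_form_def re3_def plane_add plane_scaleR inner_add_left algebra_simps)

lemma elastic_form_invariant:
  assumes "Q \<in> oplus_Z2c D3"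
  shows "elastic_form c (u v* Q) (v v* Q) (w v* Q) (y v* Q)
    = elastic_form c u v w y"
proof -
  \<comment> \<open>The arguments are packed into a family indexed by naturals, of which
    \<open>F\<close> reads the first four entries.\<close>
  define F where "F = (\<lambda>x :: nat \<Rightarrow> real^3. elastic_form c (x 0) (x 1) (x 2) (x 3))"
  have "F (\<lambda>k. ([u, v, w, y] ! k) v* Q) = F (\<lambda>k. [u, v, w, y] ! k)"
  proof (rule oplus_Z2c_D3_invariant[OF _ _ _ assms])
    show "F (\<lambda>k. x k v* rot_e3 (2 * pi / 3)) = F x" for x
      by (simp add: F_def elastic_form_def re3_rot_e3 inner_mult_O3[OF rot_e3_in_O3] rot_e3_nth_3)
    show "F (\<lambda>k. x k v* rot_e2 pi) = F x" for x
      by (simp add: F_def elastic_form_def re3_rot_e2_pi inner_mult_O3[OF rot_e2_in_O3] rot_e2_pi_nth_3)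
    show "F (\<lambda>k. - x k) = F x" for x
      by (simp add: F_def elastic_form_def re3_uminus)
  qed
  then show ?thesis by (simp add: F_def)
qed

definition elastic_tensor :: "(nat \<Rightarrow> real) \<Rightarrow> tensor4" where
  "elastic_tensor c i j l m = elastic_form c (axis i 1) (axis j 1) (axis l 1) (axis m 1)"

lemma invariant4_elastic_tensor: "invariant4 (oplus_Z2c D3) (elastic_tensor c)"
  unfolding elastic_tensor_def[abs_def]
proof (rule invariant4_form)
  show lin: "linear (\<lambda>u. elastic_form c u v w y)" for v w y
    by (rule linear_elastic_form)
  then show lin': "linear (\<lambda>v. elastic_form c u v w y)" for u w y
    by (subst elastic_form_commute)
  show "linear (\<lambda>w. elastic_form c u v w y)" for u v y
    by (subst elastic_form_swap) (rule lin)
  show "linear (\<lambda>y. elastic_form c u v w y)" for u v w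
    by (subst elastic_form_swap) (rule lin')
qed (rule elastic_form_invariant)

text \<open>Symmetry of \<open>im3\<close> and of the product \<open>u$3 * v$3\<close> yields the
  index symmetries of \<open>M\<close>. Being of odd order, the form changes sign under inversion,
  but \<open>M\<close> is only subject to \<open>Z3\<close>.\<close>

definition coupling_form :: "real^3 \<Rightarrow> real^3 \<Rightarrow> real^3 \<Rightarrow> real^3 \<Rightarrow> real^3 \<Rightarrow> real" where
  "coupling_form u v w y t = u$3 * v$3 * im3 w y t"

lemma coupling_form_invariant:
  assumes "Q \<in> Z3"
  shows "coupling_form (u v* Q) (v v* Q) (w v* Q) (y v* Q)
    (t v* Q) = coupling_form u v w y t"
proof -
  define F where "F = (\<lambda>x :: nat \<Rightarrow> real^3. coupling_form (x 0) (x 1) (x 2) (x 3) (x 4))"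
  have "F (\<lambda>k. ([u, v, w, y, t] ! k) v* Q) = F (\<lambda>k. [u, v, w, y, t] ! k)"
  proof (rule Z3_invariant[OF _ assms])
    show "F (\<lambda>k. x k v* rot_e3 (2 * pi / 3)) = F x" for x
      by (simp add: F_def coupling_form_def im3_rot_e3 rot_e3_nth_3)
  qed
  then show ?thesis by (simp add: F_def)
qed

definition coupling_tensor :: tensor5 where
  "coupling_tensor i j l m n = coupling_form (axis i 1) (axis j 1) (axis l 1) (axis m 1) (axis n 1)"

lemma invariant5_coupling_tensor: "invariant5 Z3 coupling_tensor"
  unfolding coupling_tensor_def[abs_def]
proof (rule invariant5_form)
  fix Q u v w y t assume "Q \<in> Z3"
  then show "coupling_form (u v* Q) (v v* Q) (w v* Q) (y v* Q) (t v* Q) = coupling_form u v w y t"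
    by (rule coupling_form_invariant)
qed (rule linearI;
  simp add: coupling_form_def im3_def plane_add plane_scaleR algebra_simps)+

lemma invariant_zero:
  "invariant4 G (\<lambda>_ _ _ _. 0)" "invariant5 G (\<lambda>_ _ _ _ _. 0)" "invariant6 G (\<lambda>_ _ _ _ _ _. 0)"
  by (simp_all add: invariant4_def invariant5_def invariant6_def)

lemma elastic_material: "(elastic_tensor c, \<lambda>_ _ _ _ _. 0, \<lambda>_ _ _ _ _ _. 0) \<in> trigonal_Z3"
  by (auto simp: trigonal_Z3_def strain_gradient_material_def invariant_zero
      invariant4_elastic_tensor elastic_tensor_def intro: elastic_form_commute elastic_form_swap)

lemma coupling_material: "(\<lambda>_ _ _ _. 0, coupling_tensor, \<lambda>_ _ _ _ _ _. 0) \<in> trigonal_Z3"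
  by (auto simp: trigonal_Z3_def strain_gradient_material_def invariant_zero
      invariant5_coupling_tensor coupling_tensor_def coupling_form_def im3_def ac_simps)


section \<open>Algebra of the gradients\<close>

lemma axis_nth: "axis i (1::real) $ k = (if k = i then 1 else 0)"
  by (simp add: axis_def)

text \<open>Entry \<open>l m j\<close> is the second partial in directions \<open>m\<close> and
  \<open>j\<close> of component \<open>l\<close> of \<open>u_inh\<close>; the final \<open>0\<close>
  is a whole zero row.\<close>

definition second_gradient :: "real \<Rightarrow> real \<Rightarrow> real \<Rightarrow> real \<Rightarrow> 3 \<Rightarrow> 3 \<Rightarrow> 3 \<Rightarrow> real" where
  "second_gradient a12 a13 a23 b13 l m j = (vector
     [vector [vector [0, a12, a13], vector [a12, 0, a23], vector [a13, a23, 0]],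
      vector [vector [a12, 0, b13], vector [0, - a12, - a13], vector [b13, - a13, 0]],
      vector [vector [- 2 * a13, - (a23 + b13), 0], vector [- (a23 + b13), 2 * a13, 0], 0]]
     :: real^3^3^3) $ l $ m $ j"

lemma second_gradient_commute: "second_gradient a b c d l m j = second_gradient a b c d l j m"
  using exhaust_3[of l] exhaust_3[of m] exhaust_3[of j]
  by (auto simp: second_gradient_def vector_3)

text \<open>Symmetry leaves 18 entries of \<open>D\<close>, and the six elastic terms yield 14
  linear relations, so four parameters remain. The statement is purely algebraic in order to apply
  to the second gradient and to each of its derivatives.\<close>

lemma elastic_equations:
  fixes D :: "3 \<Rightarrow> 3 \<Rightarrow> 3 \<Rightarrow> real"
  assumes sym: "\<And>l m j. D l m j = D l j m"
    and eq: "\<And>c i. (\<Sum>j\<in>UNIV. \<Sum>l\<in>UNIV. \<Sum>m\<in>UNIV. elastic_tensor c i j l m * D l m j) = 0"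
  shows "D = second_gradient (D 1 1 2) (D 1 1 3) (D 1 2 3) (D 2 1 3)"
proof -
  have s: "D l 2 1 = D l 1 2" "D l 3 1 = D l 1 3" "D l 3 2 = D l 2 3" for l
    by (rule sym)+
  note simps = sum_3 elastic_tensor_def elastic_form_def re3_def plane_axis inner_axis_axis s
  \<comment> \<open>Setting one coefficient to 1 and the others to 0 tests each elastic term
    separately.\<close>
  have e: "(\<Sum>j\<in>UNIV. \<Sum>l\<in>UNIV. \<Sum>m\<in>UNIV.
      elastic_tensor (\<lambda>n. if n = k then 1 else 0) i j l m * D l m j) = 0" for k i
    by (rule eq)
  note e0 = e[of 0 1] e[of 0 2] e[of 0 3] and e1 = e[of 1 1] e[of 1 2] e[of 1 3]
    and e2 = e[of 2 3] and e3 = e[of 3 1] e[of 3 2] e[of 3 3]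
    and e4 = e[of 4 1] e[of 4 2] e[of 4 3] and e5 = e[of 5 1] e[of 5 2] e[of 5 3]
  note e0 = e0[simplified simps axis_nth, simplified]
  note e1 = e1[simplified simps axis_nth, simplified]
  note e2 = e2[simplified simps axis_nth, simplified]
  note e3 = e3[simplified simps axis_nth, simplified]
  note e4 = e4[simplified simps axis_nth, simplified]
  note e5 = e5[simplified simps axis_nth, simplified]
  \<comment> \<open>First the five entries with at least two indices equal to 3; the trigonal
    equations \<open>e5\<close> are brought in for the other nine relations.\<close>
  have "D 3 1 3 = 0" "D 3 2 3 = 0" "D 3 3 3 = 0" "D 1 3 3 = 0" "D 2 3 3 = 0"
    using e0 e1 e2 e3 e4 by linarith+
  moreover have "D 1 1 1 = 0" "D 1 2 2 = 0" "D 2 1 1 = D 1 1 2" "D 2 2 2 = - D 1 1 2" "D 2 1 2 = 0"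
    "D 2 2 3 = - D 1 1 3" "D 3 1 1 = - 2 * D 1 1 3" "D 3 2 2 = 2 * D 1 1 3"
    "D 3 1 2 = - (D 1 2 3 + D 2 1 3)"
    using e0 e1 e2 e3 e4 e5 by linarith+
  ultimately have "D l m j = second_gradient (D 1 1 2) (D 1 1 3) (D 1 2 3) (D 2 1 3) l m j" for l m j
    using exhaust_3[of l] exhaust_3[of m] exhaust_3[of j] s
    by (auto simp: second_gradient_def vector_3)
  then show ?thesis by (intro ext)
qed

text \<open>Each slice in \<open>j\<close> has four parameters. Total symmetry in the last three
  indices leaves only p = \<open>T 1 1 2 3\<close>, the third gradient of the field with components
  p x1 x2 x3, p x3 (x1^2 - x2^2) / 2 and p (x2^3 / 3 - x1^2 x2). There the coupling equation reads 4
  p = 0.\<close>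

lemma coupling_equation:
  fixes T :: "3 \<Rightarrow> 3 \<Rightarrow> 3 \<Rightarrow> 3 \<Rightarrow> real"
  assumes sym: "\<And>l m n j. T l m n j = T l n m j" "\<And>l m n j. T l m n j = T l m j n"
    and T: "\<And>j. \<exists>a b c d. (\<lambda>l m n. T l m n j) = second_gradient a b c d"
    and eq: "(\<Sum>j\<in>UNIV. \<Sum>l\<in>UNIV. \<Sum>m\<in>UNIV. \<Sum>n\<in>UNIV.
        coupling_tensor 3 j l m n * ((T l m n j + T m l n j) / 2)) -
      (\<Sum>j\<in>UNIV. \<Sum>k\<in>UNIV. \<Sum>l\<in>UNIV. \<Sum>m\<in>UNIV.
        coupling_tensor l m 3 j k * ((T l m j k + T m l j k) / 2)) = 0"
  shows "T l m n j = 0"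
proof -
  obtain a b c d where abcd: "\<And>j. (\<lambda>l m n. T l m n j) = second_gradient (a j) (b j) (c j) (d j)"
    using T by metis
  have T': "T l m n j = second_gradient (a j) (b j) (c j) (d j) l m n" for l m n j
    using fun_cong[OF fun_cong[OF fun_cong[OF abcd[of j], of l], of m], of n] .
  \<comment> \<open>The second sum vanishes because \<open>im3\<close> has the third basis vector
    among its arguments. The first keeps only \<open>j = 3\<close>, with the coefficients of Im (x1
    + i x2)^3.\<close>
  have eq': "T 1 1 2 3 + T 1 2 1 3 + T 2 1 1 3 - T 2 2 2 3 = 0"
    using eq by (simp add: sum_3 coupling_tensor_def coupling_form_def im3_def plane_axis axis_nth field_simps)
  note ex = sym(2)[of _ _ 1 2] sym(2)[of _ _ 1 3] sym(2)[of _ _ 2 3]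
  note t = ex[unfolded T' second_gradient_def]
  note t' = eq'[unfolded T' second_gradient_def, simplified vector_3, simplified]
  have "a j = 0 \<and> b j = 0 \<and> c j = 0 \<and> d j = 0" for j
    using t(1)[of 1 1] t(1)[of 1 2] t(1)[of 1 3] t(1)[of 2 1] t(1)[of 2 2] t(1)[of 2 3]
      t(1)[of 3 1] t(1)[of 3 2] t(1)[of 3 3]
      t(2)[of 1 1] t(2)[of 1 2] t(2)[of 1 3] t(2)[of 2 1] t(2)[of 2 2] t(2)[of 2 3]
      t(2)[of 3 1] t(2)[of 3 2] t(2)[of 3 3]
      t(3)[of 1 1] t(3)[of 1 2] t(3)[of 1 3] t(3)[of 2 1] t(3)[of 2 2] t(3)[of 2 3]
      t(3)[of 3 1] t(3)[of 3 2] t(3)[of 3 3] t' exhaust_3[of j]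
    by (simp add: vector_3) (elim disjE; simp)
  then show ?thesis
    unfolding T' using exhaust_3[of l] exhaust_3[of m] exhaust_3[of n]
    by (auto simp: second_gradient_def vector_3)
qed

lemma rot_e3_in_oplus_D3: "rot_e3 (2 * pi / 3) \<in> oplus_Z2c D3"
  and rot_e2_in_oplus_D3: "rot_e2 pi \<in> oplus_Z2c D3"
  by (auto simp: oplus_Z2c_def D3_def Z3_def intro!: generate.incl)

text \<open>Here \<open>C\<close> is arbitrary in the class. Instead of parametrizing it, linear
  relations between its entries are read off from two generators, and these make the sums
  cancel.\<close>

lemma trigonal_elastic_equilibrium:
  assumes sym: "\<And>i j l m. C i j l m = C j i l m" "\<And>i j l m. C i j l m = C l m i j"
    and inv: "invariant4 (oplus_Z2c D3) C"
  shows "(\<Sum>j\<in>UNIV. \<Sum>l\<in>UNIV. \<Sum>m\<in>UNIV. C i j l m * second_gradient a12 a13 a23 b13 l m j) = 0"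
proof -
  have sym': "C i j l m = C i j m l" for i j l m
    by (metis sym)
  \<comment> \<open>As rewrite rules, \<open>canon1\<close> sorts each index pair and
    \<open>canon2\<close> orders the two pairs, leaving 21 entries.\<close>
  have canon1: "C 2 1 l m = C 1 2 l m" "C 3 1 l m = C 1 3 l m" "C 3 2 l m = C 2 3 l m"
    "C l m 2 1 = C l m 1 2" "C l m 3 1 = C l m 1 3" "C l m 3 2 = C l m 2 3" for l m
    by (rule sym sym')+
  have canon2: "C 2 2 1 1 = C 1 1 2 2" "C 3 3 1 1 = C 1 1 3 3" "C 3 3 2 2 = C 2 2 3 3"
    "C 1 2 1 1 = C 1 1 1 2" "C 1 3 1 1 = C 1 1 1 3" "C 2 3 1 1 = C 1 1 2 3"
    "C 1 2 2 2 = C 2 2 1 2" "C 1 3 2 2 = C 2 2 1 3" "C 2 3 2 2 = C 2 2 2 3"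
    "C 1 2 3 3 = C 3 3 1 2" "C 1 3 3 3 = C 3 3 1 3" "C 2 3 3 3 = C 3 3 2 3"
    "C 1 3 1 2 = C 1 2 1 3" "C 2 3 1 2 = C 1 2 2 3" "C 2 3 1 3 = C 1 3 2 3"
    by (rule sym(2))+
  note canon = canon1 canon2
  have e2: "(\<Sum>j1\<in>UNIV. \<Sum>j2\<in>UNIV. \<Sum>j3\<in>UNIV. \<Sum>j4\<in>UNIV.
      rot_e2 pi $ i1 $ j1 * rot_e2 pi $ i2 $ j2 * rot_e2 pi $ i3 $ j3 * rot_e2 pi $ i4 $ j4 *
      C j1 j2 j3 j4) = C i1 i2 i3 i4" for i1 i2 i3 i4
    using inv rot_e2_in_oplus_D3 unfolding invariant4_def by blast
  \<comment> \<open>The rotation by pi is diag(-1, 1, -1), so an entry with an odd number of indices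
    2 equals its own negative.\<close>
  have parity: "C 1 1 1 2 = 0" "C 1 1 2 3 = 0" "C 2 2 1 2 = 0" "C 2 2 2 3 = 0" "C 3 3 1 2 = 0"
    "C 3 3 2 3 = 0" "C 1 2 1 3 = 0" "C 1 3 2 3 = 0"
    using e2[of 1 1 1 2] e2[of 1 1 2 3] e2[of 2 2 1 2] e2[of 2 2 2 3] e2[of 3 3 1 2] e2[of 3 3 2 3]
      e2[of 1 2 1 3] e2[of 1 3 2 3]
    by (simp_all add: sum_3 rot_e2_def vector_3)
  \<comment> \<open>The sine of 120 degrees stays a symbol; \<open>ss\<close> and \<open>ss'\<close>
    reduce its products to rational arithmetic.\<close>
  define s :: real where "s = sqrt 3 / 2"
  have ss: "s * s = 3 / 4" by (simp add: s_def)
  have ss': "s * (s * r) = 3 / 4 * r" for r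
    using ss by (simp flip: mult.assoc)
  have R: "rot_e3 (2 * pi / 3) = vector [vector [- 1 / 2, - s, 0], vector [s, - 1 / 2, 0], vector [0, 0, 1]]"
    by (simp add: rot_e3_def cos_120 sin_120 s_def)
  have e3: "(\<Sum>j1\<in>UNIV. \<Sum>j2\<in>UNIV. \<Sum>j3\<in>UNIV. \<Sum>j4\<in>UNIV.
      rot_e3 (2 * pi / 3) $ i1 $ j1 * rot_e3 (2 * pi / 3) $ i2 $ j2 * rot_e3 (2 * pi / 3) $ i3 $ j3 *
      rot_e3 (2 * pi / 3) $ i4 $ j4 * C j1 j2 j3 j4) = C i1 i2 i3 i4" for i1 i2 i3 i4
    using inv rot_e3_in_oplus_D3 unfolding invariant4_def by blast
  note e3 = e3[unfolded R]
  have "C 2 2 2 2 = C 1 1 2 2 + 2 * C 1 2 1 2"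
    using e3[of 1 1 1 1] e3[of 1 1 2 2]
    by (simp add: sum_3 vector_3 canon parity ss ss' algebra_simps)
  moreover have "C 2 2 1 3 = - C 1 1 1 3" "C 1 2 2 3 = - C 1 1 1 3"
    using e3[of 1 1 1 3] e3[of 2 2 1 3]
    by (simp_all add: sum_3 vector_3 canon parity ss ss' algebra_simps) (simp_all add: field_simps)
  moreover have "C 1 1 3 3 = C 2 2 3 3" "C 1 3 1 3 = C 2 3 2 3"
    using e3[of 1 1 3 3] e3[of 1 3 1 3]
    by (simp_all add: sum_3 vector_3 canon parity ss ss' algebra_simps)
  ultimately show ?thesis
    using exhaust_3[of i]
    by (auto simp: sum_3 second_gradient_def vector_3 canon parity algebra_simps)
qed


section \<open>Equilibrium equations\<close>

lemma differentiable_cmult: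
  fixes f :: "real^3 \<Rightarrow> real"
  shows "f differentiable (at x) \<Longrightarrow> (\<lambda>y. c * f y) differentiable (at x)"
  by (intro differentiable_mult differentiable_const)

lemma pd_double_sum:
  fixes c :: "3 \<Rightarrow> 3 \<Rightarrow> real"
  assumes "\<And>l m. f l m differentiable (at x)"
  shows "pd j (\<lambda>y. \<Sum>l\<in>UNIV. \<Sum>m\<in>UNIV. c l m * f l m y) x =
    (\<Sum>l\<in>UNIV. \<Sum>m\<in>UNIV. c l m * pd j (f l m) x)"
  by (simp add: pd_sum pd_cmult differentiable_sum differentiable_cmult assms)

lemma pd_triple_sum:
  fixes c :: "3 \<Rightarrow> 3 \<Rightarrow> 3 \<Rightarrow> real"
  assumes "\<And>l m n. f l m n differentiable (at x)"
  shows "pd j (\<lambda>y. \<Sum>l\<in>UNIV. \<Sum>m\<in>UNIV. \<Sum>n\<in>UNIV. c l m n * f l m n y) x =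
    (\<Sum>l\<in>UNIV. \<Sum>m\<in>UNIV. \<Sum>n\<in>UNIV. c l m n * pd j (f l m n) x)"
  by (simp add: pd_sum pd_cmult differentiable_sum differentiable_cmult assms)

text \<open>This is the common shape of stress, hyper-stress and the first derivatives of
  hyper-stress, so one rule differentiates all three.\<close>

lemma pd_constitutive:
  fixes a :: "3 \<Rightarrow> 3 \<Rightarrow> real" and b :: "3 \<Rightarrow> 3 \<Rightarrow> 3 \<Rightarrow> real"
  assumes "\<And>l m. f l m differentiable (at x)" "\<And>l m n. g l m n differentiable (at x)"
  shows "pd j (\<lambda>y. (\<Sum>l\<in>UNIV. \<Sum>m\<in>UNIV. a l m * f l m y) +
      (\<Sum>l\<in>UNIV. \<Sum>m\<in>UNIV. \<Sum>n\<in>UNIV. b l m n * g l m n y)) x =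
    (\<Sum>l\<in>UNIV. \<Sum>m\<in>UNIV. a l m * pd j (f l m) x) +
    (\<Sum>l\<in>UNIV. \<Sum>m\<in>UNIV. \<Sum>n\<in>UNIV. b l m n * pd j (g l m n) x)"
  by (subst pd_add)
     (simp_all add: pd_double_sum pd_triple_sum differentiable_sum differentiable_cmult assms)

context
  fixes \<Omega> :: "(real^3) set" and u :: "real^3 \<Rightarrow> real^3"
  assumes op: "open \<Omega>" and disp: "displacement_field \<Omega> u"
begin

lemma smooth_on_component: "smooth_on \<Omega> (\<lambda>y. u y $ l)"
  using disp by (simp add: displacement_field_def smooth_on_def)

lemma strain_eq: "strain u l m = (\<lambda>x. 1 / 2 * (pd m (\<lambda>y. u y $ l) x + pd l (\<lambda>y. u y $ m) x))"
  by (simp add: strain_def fun_eq_iff)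

lemma smooth_on_strain: "smooth_on \<Omega> (strain u l m)"
  unfolding strain_eq by (intro smooth_on_cmult smooth_on_add smooth_on_pd smooth_on_component op)

lemmas differentiable_intros =
  smooth_on_imp_differentiable[OF _ op] smooth_on_pd smooth_on_component smooth_on_strain

lemma pd_half_sum:
  assumes "smooth_on \<Omega> f" "smooth_on \<Omega> g" "x \<in> \<Omega>"
  shows "pd j (\<lambda>x. 1 / 2 * (f x + g x)) x = 1 / 2 * (pd j f x + pd j g x)"
  by (subst pd_cmult)
     (auto intro!: differentiable_intros differentiable_add pd_add assms)

lemma pd_strain:
  assumes "x \<in> \<Omega>"
  shows "pd j (strain u l m) x = 1 / 2 * (pd j (pd m (\<lambda>y. u y $ l)) x + pd j (pd l (\<lambda>y. u y $ m)) x)"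
  unfolding strain_eq by (intro pd_half_sum differentiable_intros assms)

lemma pd_pd_strain:
  assumes "x \<in> \<Omega>"
  shows "pd k (pd j (strain u l m)) x =
    1 / 2 * (pd k (pd j (pd m (\<lambda>y. u y $ l))) x + pd k (pd j (pd l (\<lambda>y. u y $ m))) x)"
proof -
  have "pd k (pd j (strain u l m)) x =
      pd k (\<lambda>x. 1 / 2 * (pd j (pd m (\<lambda>y. u y $ l)) x + pd j (pd l (\<lambda>y. u y $ m)) x)) x"
    by (rule pd_cong[OF op assms pd_strain])
  then show ?thesis
    by (subst (asm) pd_half_sum) (auto intro!: differentiable_intros assms)
qed

lemma pd_stress:
  assumes "x \<in> \<Omega>"
  shows "pd k (stress (C, M, A) u i j) x =
    (\<Sum>l\<in>UNIV. \<Sum>m\<in>UNIV. C i j l m * pd k (strain u l m) x) +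
    (\<Sum>l\<in>UNIV. \<Sum>m\<in>UNIV. \<Sum>n\<in>UNIV. M i j l m n * pd k (pd n (strain u l m)) x)"
  unfolding stress_def prod.case
  by (rule pd_constitutive) (auto intro!: differentiable_intros assms)

lemma pd_pd_hyper_stress:
  assumes "x \<in> \<Omega>"
  shows "pd q (pd p (hyper_stress (C, M, A) u i j k)) x =
    (\<Sum>l\<in>UNIV. \<Sum>m\<in>UNIV. M l m i j k * pd q (pd p (strain u l m)) x) +
    (\<Sum>l\<in>UNIV. \<Sum>m\<in>UNIV. \<Sum>n\<in>UNIV. A i j k l m n * pd q (pd p (pd n (strain u l m))) x)"
proof -
  have "pd p (hyper_stress (C, M, A) u i j k) y =
      (\<Sum>l\<in>UNIV. \<Sum>m\<in>UNIV. M l m i j k * pd p (strain u l m) y) +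
      (\<Sum>l\<in>UNIV. \<Sum>m\<in>UNIV. \<Sum>n\<in>UNIV. A i j k l m n * pd p (pd n (strain u l m)) y)"
    if "y \<in> \<Omega>" for y
    unfolding hyper_stress_def prod.case
    by (rule pd_constitutive) (auto intro!: differentiable_intros that)
  then have "pd q (pd p (hyper_stress (C, M, A) u i j k)) x = pd q (\<lambda>y.
      (\<Sum>l\<in>UNIV. \<Sum>m\<in>UNIV. M l m i j k * pd p (strain u l m) y) +
      (\<Sum>l\<in>UNIV. \<Sum>m\<in>UNIV. \<Sum>n\<in>UNIV. A i j k l m n * pd p (pd n (strain u l m)) y)) x"
    by (rule pd_cong[OF op assms])
  also have "\<dots> = (\<Sum>l\<in>UNIV. \<Sum>m\<in>UNIV. M l m i j k * pd q (pd p (strain u l m)) x) +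
      (\<Sum>l\<in>UNIV. \<Sum>m\<in>UNIV. \<Sum>n\<in>UNIV. A i j k l m n * pd q (pd p (pd n (strain u l m))) x)"
    by (rule pd_constitutive) (auto intro!: differentiable_intros assms)
  finally show ?thesis .
qed

text \<open>All derivatives are moved onto the strain, so that each constitutive tensor contributes
  a separate linear expression.\<close>

lemma equilibrium_iff:
  "equilibrium \<Omega> (C, M, A) u \<longleftrightarrow> (\<forall>x\<in>\<Omega>. \<forall>i.
     (\<Sum>j\<in>UNIV. (\<Sum>l\<in>UNIV. \<Sum>m\<in>UNIV. C i j l m * pd j (strain u l m) x) +
       (\<Sum>l\<in>UNIV. \<Sum>m\<in>UNIV. \<Sum>n\<in>UNIV. M i j l m n * pd j (pd n (strain u l m)) x)) -
     (\<Sum>j\<in>UNIV. \<Sum>k\<in>UNIV. (\<Sum>l\<in>UNIV. \<Sum>m\<in>UNIV. M l m i j k * pd k (pd j (strain u l m)) x) +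
       (\<Sum>l\<in>UNIV. \<Sum>m\<in>UNIV. \<Sum>n\<in>UNIV. A i j k l m n * pd k (pd j (pd n (strain u l m))) x)) = 0)"
  unfolding equilibrium_def by (simp add: pd_stress pd_pd_hyper_stress)

text \<open>Symmetry in the last two indices makes both halves of the strain contribute equally, so
  the displacement gradient may replace it.\<close>

lemma elastic_sum:
  assumes "x \<in> \<Omega>" "\<And>i j l m. C i j l m = C i j m l"
  shows "(\<Sum>j\<in>UNIV. \<Sum>l\<in>UNIV. \<Sum>m\<in>UNIV. C i j l m * pd j (strain u l m) x) =
    (\<Sum>j\<in>UNIV. \<Sum>l\<in>UNIV. \<Sum>m\<in>UNIV. C i j l m * pd j (pd m (\<lambda>y. u y $ l)) x)"
proof (rule sum.cong[OF refl])
  fix j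
  have swap: "(\<Sum>l\<in>UNIV. \<Sum>m\<in>UNIV. C i j l m * pd j (pd l (\<lambda>y. u y $ m)) x) =
      (\<Sum>l\<in>UNIV. \<Sum>m\<in>UNIV. C i j l m * pd j (pd m (\<lambda>y. u y $ l)) x)"
    by (subst sum.swap) (simp add: assms(2)[of i j])
  have "(\<Sum>l\<in>UNIV. \<Sum>m\<in>UNIV. C i j l m * pd j (strain u l m) x) =
      1 / 2 * ((\<Sum>l\<in>UNIV. \<Sum>m\<in>UNIV. C i j l m * pd j (pd m (\<lambda>y. u y $ l)) x) +
        (\<Sum>l\<in>UNIV. \<Sum>m\<in>UNIV. C i j l m * pd j (pd l (\<lambda>y. u y $ m)) x))"
    by (simp add: pd_strain assms(1) sum.distrib sum_distrib_left sum_divide_distrib algebra_simps)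
  then show "(\<Sum>l\<in>UNIV. \<Sum>m\<in>UNIV. C i j l m * pd j (strain u l m) x) =
      (\<Sum>l\<in>UNIV. \<Sum>m\<in>UNIV. C i j l m * pd j (pd m (\<lambda>y. u y $ l)) x)"
    unfolding swap by simp
qed

text \<open>Both gradients solve the same linear system: the elastic equations hold throughout
  \<Omega> with constant coefficients, so they may be differentiated once more.\<close>

lemma universal_imp_second_gradient:
  assumes "universal \<Omega> trigonal_Z3 u"
    and "x \<in> \<Omega>"
  shows "\<exists>a b c d. (\<lambda>l m j. pd j (pd m (\<lambda>y. u y $ l)) x) = second_gradient a b c d"
    and "\<exists>a b c d. (\<lambda>l m j. pd k (pd j (pd m (\<lambda>y. u y $ l))) x) = second_gradient a b c d"
proof -
  let ?u = "\<lambda>l y. u y $ l"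
  have sym: "pd j (pd m (?u l)) y = pd m (pd j (?u l)) y" if "y \<in> \<Omega>" for l m j y
    by (rule pd_commute[OF op that smooth_on_component])
  have eq: "(\<Sum>j\<in>UNIV. \<Sum>l\<in>UNIV. \<Sum>m\<in>UNIV. elastic_tensor c i j l m * pd j (pd m (?u l)) y) = 0"
    if "y \<in> \<Omega>" for c i y
  proof -
    have "equilibrium \<Omega> (elastic_tensor c, \<lambda>_ _ _ _ _. 0, \<lambda>_ _ _ _ _ _. 0) u"
      using assms(1) elastic_material by (auto simp: universal_def)
    moreover have "elastic_tensor c i j l m = elastic_tensor c i j m l" for i j l m
      unfolding elastic_tensor_def by (metis elastic_form_commute elastic_form_swap)
    ultimately show ?thesis
      using that by (simp add: equilibrium_iff elastic_sum)
  qed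
  show "\<exists>a b c d. (\<lambda>l m j. pd j (pd m (?u l)) x) = second_gradient a b c d"
    by (intro exI) (rule elastic_equations, rule sym[OF assms(2)], rule eq[OF assms(2)])
  have sym': "pd k (pd j (pd m (?u l))) x = pd k (pd m (pd j (?u l))) x" for l m j
    by (rule pd_cong[OF op assms(2) sym])
  have "(\<Sum>j\<in>UNIV. \<Sum>l\<in>UNIV. \<Sum>m\<in>UNIV. elastic_tensor c i j l m * pd k (pd j (pd m (?u l))) x) =
      pd k (\<lambda>y. \<Sum>j\<in>UNIV. \<Sum>l\<in>UNIV. \<Sum>m\<in>UNIV. elastic_tensor c i j l m * pd j (pd m (?u l)) y) x" for c i
    by (rule pd_triple_sum[symmetric]) (auto intro!: differentiable_intros assms(2))
  also have "\<dots> c i = pd k (\<lambda>y. 0) x" for c i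
    by (rule pd_cong[OF op assms(2) eq])
  finally have eq': "(\<Sum>j\<in>UNIV. \<Sum>l\<in>UNIV. \<Sum>m\<in>UNIV.
      elastic_tensor c i j l m * pd k (pd j (pd m (?u l))) x) = 0" for c i
    by simp
  show "\<exists>a b c d. (\<lambda>l m j. pd k (pd j (pd m (?u l))) x) = second_gradient a b c d"
    by (intro exI) (rule elastic_equations, rule sym', rule eq')
qed

text \<open>The third equilibrium equation of the coupling material feeds
  \<open>coupling_equation\<close>; smoothness supplies the symmetries of the third
  gradient.\<close>

lemma universal_imp_third_gradient_zero:
  assumes "universal \<Omega> trigonal_Z3 u" "x \<in> \<Omega>"
  shows "pd k (pd j (pd m (\<lambda>y. u y $ l))) x = 0"
proof -
  let ?T = "\<lambda>l m n j. pd j (pd n (pd m (\<lambda>y. u y $ l))) x"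
  have "equilibrium \<Omega> (\<lambda>_ _ _ _. 0, coupling_tensor, \<lambda>_ _ _ _ _ _. 0) u"
    using assms(1) coupling_material by (auto simp: universal_def)
  then have eq: "(\<Sum>j\<in>UNIV. \<Sum>l\<in>UNIV. \<Sum>m\<in>UNIV. \<Sum>n\<in>UNIV.
        coupling_tensor 3 j l m n * ((?T l m n j + ?T m l n j) / 2)) -
      (\<Sum>j\<in>UNIV. \<Sum>k\<in>UNIV. \<Sum>l\<in>UNIV. \<Sum>m\<in>UNIV.
        coupling_tensor l m 3 j k * ((?T l m j k + ?T m l j k) / 2)) = 0"
    using assms(2) by (simp add: equilibrium_iff pd_pd_strain)
  have sym1: "?T l m n j = ?T l n m j" for l m n j
    by (rule pd_cong[OF op assms(2)], rule pd_commute[OF op _ smooth_on_component])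
  have sym2: "?T l m n j = ?T l m j n" for l m n j
    by (rule pd_commute[OF op assms(2)]) (intro smooth_on_pd smooth_on_component)
  show ?thesis
    using coupling_equation[of ?T, OF sym1 sym2 universal_imp_second_gradient(2)[OF assms] eq] .
qed

text \<open>First derivatives of strain are constant, so the terms of \<open>M\<close> and
  \<open>A\<close>, which carry two and three derivatives of strain, vanish. Those of
  \<open>C\<close> cancel by \<open>trigonal_elastic_equilibrium\<close>.\<close>

lemma const_second_gradient_imp_universal:
  assumes "\<And>x l m j. x \<in> \<Omega> \<Longrightarrow> pd j (pd m (\<lambda>y. u y $ l)) x = second_gradient a b c d l m j"
  shows "universal \<Omega> trigonal_Z3 u"
  unfolding universal_def
proof
  fix S assume S: "S \<in> trigonal_Z3"
  obtain C M A where [simp]: "S = (C, M, A)" by (cases S)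
  have C: "C i j l m = C j i l m" "C i j l m = C l m i j" "invariant4 (oplus_Z2c D3) C" for i j l m
    using S by (simp_all add: trigonal_Z3_def strain_gradient_material_def)
  have C': "C i j l m = C i j m l" for i j l m
    by (metis C(1,2))
  have e1: "pd j (strain u l m) x =
      1 / 2 * (second_gradient a b c d l m j + second_gradient a b c d m l j)"
    if "x \<in> \<Omega>" for x j l m
    using that by (simp add: pd_strain assms)
  have e2: "pd k (pd j (strain u l m)) x = 0" if "x \<in> \<Omega>" for x k j l m
    using pd_cong[OF op that e1] by simp
  have e3: "pd p (pd k (pd j (strain u l m))) x = 0" if "x \<in> \<Omega>" for x p k j l m
    using pd_cong[OF op that e2] by simp
  have "(\<Sum>j\<in>UNIV. \<Sum>l\<in>UNIV. \<Sum>m\<in>UNIV. C i j l m * pd j (strain u l m) x) = 0"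
    if "x \<in> \<Omega>" for x i
    using elastic_sum[OF that, of C i, OF C'] trigonal_elastic_equilibrium[OF C]
    by (simp add: assms[OF that])
  then show "equilibrium \<Omega> S u"
    by (simp add: equilibrium_iff e2 e3)
qed

end

section \<open>Characterization of the universal fields\<close>

lemma u_inh_eq_quadratic:
  "u_inh a12 a13 a23 b13 x $ l = quadratic (\<lambda>_. 0) (second_gradient a12 a13 a23 b13 l) x"
  using exhaust_3[of l]
  by (auto simp: u_inh_def quadratic_def second_gradient_def vector_3 sum_3 power2_eq_square
      field_simps)

lemma quadratic_eq_add: "quadratic h q x = (\<Sum>k\<in>UNIV. h k * x $ k) + quadratic (\<lambda>_. 0) q x"
  by (simp add: quadratic_def)

theorem proposition3p12:
  fixes \<Omega> :: "(real^3) set" and u :: "real^3 \<Rightarrow> real^3"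
  assumes "\<Omega> \<noteq> {}" and "open \<Omega>" and "convex \<Omega>"
    and "displacement_field \<Omega> u"
  shows "universal \<Omega> trigonal_Z3 u \<longleftrightarrow>
    (\<exists>u_hom a12 a13 a23 b13. homogeneous \<Omega> u_hom \<and>
       (\<forall>x\<in>\<Omega>. u x = u_hom x + u_inh a12 a13 a23 b13 x))"
proof
  let ?D = "\<lambda>x l m j. pd j (pd m (\<lambda>y. u y $ l)) x"
  note smooth = smooth_on_component[OF assms(2,4)]
  assume univ: "universal \<Omega> trigonal_Z3 u"
  obtain x0 where x0: "x0 \<in> \<Omega>"
    using assms(1) by blast
  \<comment> \<open>The four constants are read off at one point; the vanishing third gradient
    carries them to all of \<Omega>.\<close>
  obtain a12 a13 a23 b13 where D0: "?D x0 = second_gradient a12 a13 a23 b13"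
    using universal_imp_second_gradient(1)[OF assms(2,4) univ x0] by blast
  have D: "?D x l m j = second_gradient a12 a13 a23 b13 l m j" if x: "x \<in> \<Omega>" for x l m j
  proof -
    obtain c where "\<And>x. x \<in> \<Omega> \<Longrightarrow> ?D x l m j = c"
      by (rule pd_zero_imp_constant[OF assms(2,3), of "pd j (pd m (\<lambda>y. u y $ l))"])
        (auto intro: smooth_on_imp_differentiable[OF _ assms(2)] smooth_on_pd smooth
          universal_imp_third_gradient_zero[OF assms(2,4) univ])
    then have "?D x l m j = ?D x0 l m j"
      using x x0 by metis
    also have "\<dots> = second_gradient a12 a13 a23 b13 l m j"
      using fun_cong[OF fun_cong[OF fun_cong[OF D0, of l], of m], of j] .
    finally show ?thesis .
  qed
  have "\<exists>h b. \<forall>x\<in>\<Omega>. u x $ l = quadratic h (second_gradient a12 a13 a23 b13 l) x + b" for l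
    by (rule second_pd_const_imp_quadratic[OF assms(2,3) smooth[of l],
          of "second_gradient a12 a13 a23 b13 l"])
      (use D second_gradient_commute in blast)+
  then obtain h b where hb:
    "\<And>l x. x \<in> \<Omega> \<Longrightarrow> u x $ l = quadratic (h l) (second_gradient a12 a13 a23 b13 l) x + b l"
    by metis
  \<comment> \<open>The first-order coefficients of the components become the rows of the matrix,
    leaving \<open>u_inh\<close> as the purely quadratic part.\<close>
  define u_hom where "u_hom = (\<lambda>x. (\<chi> l k. h l k) *v x + (\<chi> l. b l))"
  have "u x = u_hom x + u_inh a12 a13 a23 b13 x" if "x \<in> \<Omega>" for x
    by (simp add: vec_eq_iff hb[OF that] quadratic_eq_add[of "h _"] u_inh_eq_quadratic u_hom_def
        matrix_vector_mult_def)
  moreover have "homogeneous \<Omega> u_hom"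
    by (auto simp: homogeneous_def u_hom_def)
  ultimately show "\<exists>u_hom a12 a13 a23 b13. homogeneous \<Omega> u_hom \<and>
      (\<forall>x\<in>\<Omega>. u x = u_hom x + u_inh a12 a13 a23 b13 x)"
    by blast
next
  assume "\<exists>u_hom a12 a13 a23 b13. homogeneous \<Omega> u_hom \<and>
      (\<forall>x\<in>\<Omega>. u x = u_hom x + u_inh a12 a13 a23 b13 x)"
  then obtain H b a12 a13 a23 b13 where
    u: "\<And>x. x \<in> \<Omega> \<Longrightarrow> u x = (H *v x + b) + u_inh a12 a13 a23 b13 x"
    by (auto simp: homogeneous_def)
  have "u x $ l = quadratic (\<lambda>k. H $ l $ k) (second_gradient a12 a13 a23 b13 l) x + b $ l"
    if "x \<in> \<Omega>" for x l
    by (simp add: u[OF that] quadratic_eq_add[of "\<lambda>k. H $ l $ k"] u_inh_eq_quadratic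
        matrix_vector_mult_def)
  then have "pd j (pd m (\<lambda>y. u y $ l)) x = second_gradient a12 a13 a23 b13 l m j"
    if "x \<in> \<Omega>" for x l m j
    using second_gradient_commute by (intro second_pd_quadratic[OF assms(2) that]) auto
  then show "universal \<Omega> trigonal_Z3 u"
    by (rule const_second_gradient_imp_universal[OF assms(2,4)])
qed

end
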